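(* Let $B$ be a complete Boolean algebra, let $p\in\mathsf{Sent}_{\in}$ be a parameter-free set-theoretic sentence (viewed as an atomic modal proposition), and let $b\in B$. Then $$M_B,b\models \Diamond p \quad\Longleftrightarrow\quad \text{there exists an ultrafilter } U \text{ on } B \text{ such that } b\in U \text{ and } V^{(B)}/U\models p.$$
   Context: Boolean-valued models. For a complete Boolean algebra $B$ (bottom $0$, top $1$, complement $a^\ast$, $a\to b:=a^\ast\vee b$), define by transfinite recursion $V^{(B)}_\alpha=\{x: x$ is a function, $\mathrm{ran}(x)\subseteq B$, and $\mathrm{dom}(x)\subseteq V^{(B)}_\xi$ for some $\xi<\alpha\}$ and $V^{(B)}=\bigcup_\alpha V^{(B)}_\alpha$. Let $L_\in$ be the first-order language of set theory, $L_B$ its expansion by a constant symbol for each element of $V^{(B)}$, and $\mathsf{Sent}(L_B)$ the class of $L_B$-sentences. The Boolean value $\llbracket\cdot\rrbracket_B:\mathsf{Sent}(L_B)\to B$ is defined recursively by $\llbracket u\in v\rrbracket_B=\bigvee_{x\in\mathrm{dom}(v)}(v(x)\wedge\llbracket x=u\rrbracket_B)$, $\llbracket u=v\rrbracket_B=\bigwedge_{x\in\mathrm{dom}(u)}(u(x)\to\llbracket x\in v\rrbracket_B)\wedge\bigwedge_{y\in\mathrm{dom}(v)}(v(y)\to\llbracket y\in u\rrbracket_B)$, the Boolean operations for the connectives, $\llbracket\forall x\,\varphi\rrbracket_B=\bigwedge_{u\in V^{(B)}}\llbracket\varphi(u)\rrbracket_B$ and $\llbracket\exists x\,\varphi\rrbracket_B=\bigvee_{u\in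 V^{(B)}}\llbracket\varphi(u)\rrbracket_B$. Filters contain $1$, do not contain $0$, are upward closed and closed under binary meets; an ultrafilter is a filter containing $a$ or $a^\ast$ for every $a\in B$. For an ultrafilter $U$ on $B$, $V^{(B)}/U$ is the two-valued structure whose elements are the classes of $u\equiv_U v\iff\llbracket u=v\rrbracket_B\in U$, with membership $[u]_U\in_U[v]_U\iff\llbracket u\in v\rrbracket_B\in U$. Internal modal semantics. $\mathsf{Sent}_{\in}$ is the (countable) set of parameter-free $L_\in$-sentences; its elements are used as the atomic propositions of the propositional modal language with $\neg,\wedge,\vee,\to,\Box,\Diamond$. On $B$ let $aRb\iff a\wedge b\neq 0$. Satisfaction in $M_B=\langle B,R,\llbracket\cdot\rrbracket_B\rangle$ at states $b\in B$: $M_B,b\models p$ iff $b\le\llbracket p\rrbracket_B$ for $p\in\mathsf{Sent}_{\in}$; modal-language Boolean connectives are interpreted classically at each state; $M_B,b\models\Box\varphi$ iff $M_B,a\models\varphi$ for all $a\in B$ with $bRa$; $M_B,b\models\Diamond\varphi$ iff $M_B,a\models\varphi$ for some $a\in B$ with $bRa$. *)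

theory Defs
  imports Complex_Main "HOL-Library.Multiset"
begin

unbundle lattice_syntax

section \<open>The ambient universe of sets\<close>

text \<open>
  A type in this class plays the role of the universe \<open>V\<close>: its elements are the sets, and a
  HOL set of elements is a class. Separation and Replacement are assumed for arbitrary classes and
  class functions, as in a class theory; this matches the recursion of Boolean values over all
  formulas, which quantifies over the class \<open>V\<^sup>(\<^sup>B\<^sup>)\<close>. The Axiom of Choice
  follows from Hilbert choice and Replacement.
\<close>

class zfc_universe =
  fixes elts :: "'a \<Rightarrow> 'a set"
  assumes extensionality: "elts x = elts y \<Longrightarrow> x = y"
    and foundation: "wf {(x, y). x \<in> elts y}"
    and pairing: "\<exists>z. elts z = {x, y}"
    and union: "\<exists>z. elts z = (\<Union>y\<in>elts x. elts y)"
    and power_set: "\<exists>z. elts z = {y. elts y \<subseteq> elts x}"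
    and infinity: "\<exists>w. (\<exists>z\<in>elts w. elts z = {}) \<and>
                       (\<forall>x\<in>elts w. \<exists>y\<in>elts w. elts y = insert x (elts x))"
    and separation: "\<exists>z. elts z = {y \<in> elts x. P y}"
    and replacement: "\<exists>z. elts z = f ` elts x"

text \<open>The set with a given class of elements; meaningful only when that class is a set.\<close>

definition vset :: "'v::zfc_universe set \<Rightarrow> 'v" where
  "vset X = inv elts X"

definition vpair :: "'v::zfc_universe \<Rightarrow> 'v \<Rightarrow> 'v" where
  "vpair a b = vset {vset {a}, vset {a, b}}"

definition vdom :: "'v::zfc_universe \<Rightarrow> 'v set" where
  "vdom f = {a. \<exists>b. vpair a b \<in> elts f}"

definition vran :: "'v::zfc_universe \<Rightarrow> 'v set" where
  "vran f = {b. \<exists>a. vpair a b \<in> elts f}"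

definition vfunction :: "'v::zfc_universe \<Rightarrow> bool" where
  "vfunction f \<longleftrightarrow>
     (\<forall>z\<in>elts f. \<exists>a b. z = vpair a b) \<and>
     (\<forall>a b c. vpair a b \<in> elts f \<longrightarrow> vpair a c \<in> elts f \<longrightarrow> b = c)"

definition vapp :: "'v::zfc_universe \<Rightarrow> 'v \<Rightarrow> 'v" where
  "vapp f a = (THE b. vpair a b \<in> elts f)"

definition vtransitive :: "'v::zfc_universe \<Rightarrow> bool" where
  "vtransitive x \<longleftrightarrow> (\<forall>y\<in>elts x. elts y \<subseteq> elts x)"

text \<open>Von Neumann ordinals; well-foundedness of membership is part of the axioms.\<close>

definition vordinal :: "'v::zfc_universe \<Rightarrow> bool" where
  "vordinal x \<longleftrightarrow> vtransitive x \<and> (\<forall>y\<in>elts x. vtransitive y)"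

lemma elts_vset: "elts z = X \<Longrightarrow> elts (vset X) = X"
  unfolding vset_def by (metis f_inv_into_f rangeI)

lemma elts_vset_pair [simp]: "elts (vset {x, y}) = {x, y}"
  using pairing elts_vset by metis

lemma elts_vset_singleton [simp]: "elts (vset {x}) = {x}"
  using elts_vset_pair[of x x] by simp

lemma elts_vpair: "elts (vpair a b) = {vset {a}, vset {a, b}}"
  unfolding vpair_def by simp

definition vmem_tc :: "('v::zfc_universe \<times> 'v) set" where
  "vmem_tc = {(x, y). x \<in> elts y}\<^sup>+"

lemma wf_vmem_tc: "wf vmem_tc"
  unfolding vmem_tc_def by (rule wf_trancl[OF foundation])

lemma trans_vmem_tc: "trans vmem_tc"
  unfolding vmem_tc_def by (rule trans_trancl)

lemma vdom_vmem_tc: assumes "a \<in> vdom f" shows "(a, f) \<in> vmem_tc"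
proof -
  let ?r = "{(x, y). x \<in> elts y}"
  obtain b where "vpair a b \<in> elts f" using assms unfolding vdom_def by blast
  moreover have "vset {a} \<in> elts (vpair a b)" by (simp add: elts_vpair)
  moreover have "a \<in> elts (vset {a})" by simp
  ultimately have "(a, vset {a}) \<in> ?r" "(vset {a}, vpair a b) \<in> ?r" "(vpair a b, f) \<in> ?r"
    by simp_all
  then show ?thesis unfolding vmem_tc_def by (meson trancl.simps)
qed

lemma mult_replace:
  assumes "(x, u) \<in> r"
  shows "({#x, w#}, {#u, w#}) \<in> mult r" "({#w, x#}, {#u, w#}) \<in> mult r"
    "({#x, w#}, {#w, u#}) \<in> mult r" "({#w, x#}, {#w, u#}) \<in> mult r"
  using one_step_implies_mult[of "{#u#}" "{#x#}" r "{#w#}"] assms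
  by (simp_all add: add_mset_commute)

section \<open>The Boolean-valued universe\<close>

text \<open>
  A complete Boolean algebra is a type of sort \<open>{boolean_algebra, complete_lattice}\<close>. The
  library class \<^class>\<open>complete_boolean_algebra\<close> is not suitable, since it demands complete
  distributivity, that is, atomicity. The injection \<open>\<iota>\<close> presents the algebra as a set of
  the universe, so that its elements can be values of functions in the universe.
\<close>

definition set_presentation :: "('b \<Rightarrow> 'v::zfc_universe) \<Rightarrow> bool" where
  "set_presentation \<iota> \<longleftrightarrow> inj \<iota> \<and> (\<exists>B. elts B = range \<iota>)"

function name_level :: "('b \<Rightarrow> 'v::zfc_universe) \<Rightarrow> 'v \<Rightarrow> 'v set" where
  "name_level \<iota> \<alpha> =
     {x. vfunction x \<and> vran x \<subseteq> range \<iota> \<and> (\<exists>\<xi>\<in>elts \<alpha>. vdom x \<subseteq> name_level \<iota> \<xi>)}"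
  by pat_completeness auto
termination
  by (relation "inv_image {(x, y). x \<in> elts y} snd") (auto intro: foundation)

declare name_level.simps [simp del]

definition names :: "('b \<Rightarrow> 'v::zfc_universe) \<Rightarrow> 'v set" where
  "names \<iota> = (\<Union>\<alpha>\<in>{\<alpha>. vordinal \<alpha>}. name_level \<iota> \<alpha>)"

definition name_val :: "('b \<Rightarrow> 'v::zfc_universe) \<Rightarrow> 'v \<Rightarrow> 'v \<Rightarrow> 'b" where
  "name_val \<iota> v x = inv \<iota> (vapp v x)"

text \<open>
  The values of \<open>u \<in> v\<close> and \<open>u = v\<close>. The recursion is total on the universe, but only
  its restriction to names is meaningful. In each call one member of the unordered pair
  \<open>{u, v}\<close> is replaced by an element of its domain.
\<close>

function mem_value :: "('b::{boolean_algebra,complete_lattice} \<Rightarrow> 'v::zfc_universe) \<Rightarrow> 'v \<Rightarrow> 'v \<Rightarrow> 'b"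
  and eq_value :: "('b \<Rightarrow> 'v) \<Rightarrow> 'v \<Rightarrow> 'v \<Rightarrow> 'b" where
  "mem_value \<iota> u v = (SUP x\<in>vdom v. name_val \<iota> v x \<sqinter> eq_value \<iota> x u)"
| "eq_value \<iota> u v =
     (INF x\<in>vdom u. - name_val \<iota> u x \<squnion> mem_value \<iota> x v) \<sqinter>
     (INF y\<in>vdom v. - name_val \<iota> v y \<squnion> mem_value \<iota> y u)"
  by pat_completeness auto
termination
proof (relation "inv_image (mult vmem_tc)
    (case_sum (\<lambda>(_, u, v). {#u, v#}) (\<lambda>(_, u, v). {#u, v#}))", goal_cases)
  case 1
  show ?case by (intro wf_inv_image wf_mult wf_vmem_tc)
qed (auto dest!: vdom_vmem_tc intro: mult_replace)

declare mem_value.simps [simp del] eq_value.simps [simp del]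

section \<open>Formulas of set theory\<close>

text \<open>
  Formulas use de Bruijn indices: a quantifier binds index \<open>0\<close> of its body. A formula together
  with a list of parameters, interpreting its free indices, represents a sentence of the language
  expanded by constants; pushing \<open>u\<close> onto the list corresponds to passing from
  \<open>\<forall>x \<phi>\<close> to \<open>\<phi>(u)\<close>.
\<close>

datatype fm =
    Member nat nat
  | Equal nat nat
  | Neg fm
  | Conj fm fm
  | Disj fm fm
  | Impl fm fm
  | Forall fm
  | Exists fm

primrec free_below :: "nat \<Rightarrow> fm \<Rightarrow> bool" where
  "free_below n (Member i j) \<longleftrightarrow> i < n \<and> j < n"
| "free_below n (Equal i j) \<longleftrightarrow> i < n \<and> j < n"
| "free_below n (Neg \<phi>) \<longleftrightarrow> free_below n \<phi>"
| "free_below n (Conj \<phi> \<psi>) \<longleftrightarrow> free_below n \<phi> \<and> free_below n \<psi>"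
| "free_below n (Disj \<phi> \<psi>) \<longleftrightarrow> free_below n \<phi> \<and> free_below n \<psi>"
| "free_below n (Impl \<phi> \<psi>) \<longleftrightarrow> free_below n \<phi> \<and> free_below n \<psi>"
| "free_below n (Forall \<phi>) \<longleftrightarrow> free_below (Suc n) \<phi>"
| "free_below n (Exists \<phi>) \<longleftrightarrow> free_below (Suc n) \<phi>"

definition sentences :: "fm set" where
  "sentences = {\<phi>. free_below 0 \<phi>}"

primrec bool_value ::
  "('b::{boolean_algebra,complete_lattice} \<Rightarrow> 'v::zfc_universe) \<Rightarrow> 'v list \<Rightarrow> fm \<Rightarrow> 'b" where
  "bool_value \<iota> us (Member i j) = mem_value \<iota> (us ! i) (us ! j)"
| "bool_value \<iota> us (Equal i j) = eq_value \<iota> (us ! i) (us ! j)"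
| "bool_value \<iota> us (Neg \<phi>) = - bool_value \<iota> us \<phi>"
| "bool_value \<iota> us (Conj \<phi> \<psi>) = bool_value \<iota> us \<phi> \<sqinter> bool_value \<iota> us \<psi>"
| "bool_value \<iota> us (Disj \<phi> \<psi>) = bool_value \<iota> us \<phi> \<squnion> bool_value \<iota> us \<psi>"
| "bool_value \<iota> us (Impl \<phi> \<psi>) = - bool_value \<iota> us \<phi> \<squnion> bool_value \<iota> us \<psi>"
| "bool_value \<iota> us (Forall \<phi>) = (INF u\<in>names \<iota>. bool_value \<iota> (u # us) \<phi>)"
| "bool_value \<iota> us (Exists \<phi>) = (SUP u\<in>names \<iota>. bool_value \<iota> (u # us) \<phi>)"

text \<open>Two-valued satisfaction in the structure with domain \<open>D\<close> and membership \<open>E\<close>.\<close>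

primrec sat :: "'d set \<Rightarrow> ('d \<Rightarrow> 'd \<Rightarrow> bool) \<Rightarrow> 'd list \<Rightarrow> fm \<Rightarrow> bool" where
  "sat D E ds (Member i j) \<longleftrightarrow> E (ds ! i) (ds ! j)"
| "sat D E ds (Equal i j) \<longleftrightarrow> ds ! i = ds ! j"
| "sat D E ds (Neg \<phi>) \<longleftrightarrow> \<not> sat D E ds \<phi>"
| "sat D E ds (Conj \<phi> \<psi>) \<longleftrightarrow> sat D E ds \<phi> \<and> sat D E ds \<psi>"
| "sat D E ds (Disj \<phi> \<psi>) \<longleftrightarrow> sat D E ds \<phi> \<or> sat D E ds \<psi>"
| "sat D E ds (Impl \<phi> \<psi>) \<longleftrightarrow> (sat D E ds \<phi> \<longrightarrow> sat D E ds \<psi>)"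
| "sat D E ds (Forall \<phi>) \<longleftrightarrow> (\<forall>d\<in>D. sat D E (d # ds) \<phi>)"
| "sat D E ds (Exists \<phi>) \<longleftrightarrow> (\<exists>d\<in>D. sat D E (d # ds) \<phi>)"

section \<open>Ultrafilters and quotients\<close>

definition ba_filter :: "'b::boolean_algebra set \<Rightarrow> bool" where
  "ba_filter F \<longleftrightarrow> \<top> \<in> F \<and> \<bottom> \<notin> F \<and>
     (\<forall>a c. a \<in> F \<longrightarrow> a \<le> c \<longrightarrow> c \<in> F) \<and>
     (\<forall>a c. a \<in> F \<longrightarrow> c \<in> F \<longrightarrow> a \<sqinter> c \<in> F)"

definition ba_ultrafilter :: "'b::boolean_algebra set \<Rightarrow> bool" where
  "ba_ultrafilter U \<longleftrightarrow> ba_filter U \<and> (\<forall>a. a \<in> U \<or> - a \<in> U)"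

definition name_equiv ::
  "('b::{boolean_algebra,complete_lattice} \<Rightarrow> 'v::zfc_universe) \<Rightarrow> 'b set \<Rightarrow> ('v \<times> 'v) set" where
  "name_equiv \<iota> U = {(u, v). u \<in> names \<iota> \<and> v \<in> names \<iota> \<and> eq_value \<iota> u v \<in> U}"

definition quotient_domain ::
  "('b::{boolean_algebra,complete_lattice} \<Rightarrow> 'v::zfc_universe) \<Rightarrow> 'b set \<Rightarrow> 'v set set" where
  "quotient_domain \<iota> U = names \<iota> // name_equiv \<iota> U"

definition quotient_mem ::
  "('b::{boolean_algebra,complete_lattice} \<Rightarrow> 'v::zfc_universe) \<Rightarrow> 'b set \<Rightarrow> 'v set \<Rightarrow> 'v set \<Rightarrow> bool"
  where
  "quotient_mem \<iota> U X Y \<longleftrightarrow>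
     (\<exists>u\<in>names \<iota>. \<exists>v\<in>names \<iota>. X = name_equiv \<iota> U `` {u} \<and> Y = name_equiv \<iota> U `` {v} \<and>
        mem_value \<iota> u v \<in> U)"

definition quotient_models ::
  "('b::{boolean_algebra,complete_lattice} \<Rightarrow> 'v::zfc_universe) \<Rightarrow> 'b set \<Rightarrow> fm \<Rightarrow> bool" where
  "quotient_models \<iota> U \<phi> \<longleftrightarrow> sat (quotient_domain \<iota> U) (quotient_mem \<iota> U) [] \<phi>"

section \<open>Internal modal semantics\<close>

datatype 'p modal =
    Atom 'p
  | MNeg "'p modal"
  | MConj "'p modal" "'p modal"
  | MDisj "'p modal" "'p modal"
  | MImpl "'p modal" "'p modal"
  | Box "'p modal"
  | Diamond "'p modal"

definition compat :: "'b::boolean_algebra \<Rightarrow> 'b \<Rightarrow> bool" where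
  "compat a b \<longleftrightarrow> a \<sqinter> b \<noteq> \<bottom>"

text \<open>The states are all elements of the algebra, including \<open>\<bottom>\<close>.\<close>

primrec modal_sat :: "('p \<Rightarrow> 'b::boolean_algebra) \<Rightarrow> 'b \<Rightarrow> 'p modal \<Rightarrow> bool" where
  "modal_sat val b (Atom p) \<longleftrightarrow> b \<le> val p"
| "modal_sat val b (MNeg \<phi>) \<longleftrightarrow> \<not> modal_sat val b \<phi>"
| "modal_sat val b (MConj \<phi> \<psi>) \<longleftrightarrow> modal_sat val b \<phi> \<and> modal_sat val b \<psi>"
| "modal_sat val b (MDisj \<phi> \<psi>) \<longleftrightarrow> modal_sat val b \<phi> \<or> modal_sat val b \<psi>"
| "modal_sat val b (MImpl \<phi> \<psi>) \<longleftrightarrow> (modal_sat val b \<phi> \<longrightarrow> modal_sat val b \<psi>)"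
| "modal_sat val b (Box \<phi>) \<longleftrightarrow> (\<forall>a. compat b a \<longrightarrow> modal_sat val a \<phi>)"
| "modal_sat val b (Diamond \<phi>) \<longleftrightarrow> (\<exists>a. compat b a \<and> modal_sat val a \<phi>)"

definition internal_sat ::
  "('b::{boolean_algebra,complete_lattice} \<Rightarrow> 'v::zfc_universe) \<Rightarrow> 'b \<Rightarrow> fm modal \<Rightarrow> bool" where
  "internal_sat \<iota> b \<phi> \<longleftrightarrow> modal_sat (bool_value \<iota> []) b \<phi>"

end

theory Submission
  imports Defs
begin

text \<open>
  The left-hand side says that \<open>b\<close> meets the value of \<open>p\<close>, hence that some
  ultrafilter contains both. What remains is Los's theorem: a sentence holds in the
  quotient exactly when its value lies in the ultrafilter. Its quantifier step rests on the
  maximum principle: choosing a maximal antichain of conditions that each force some witness and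
  mixing these witnesses along it yields one name that attains the supremum.
\<close>

section \<open>Complete Boolean algebras\<close>

text \<open>Meeting with \<open>a\<close> is left adjoint to joining with \<open>- a\<close>, so it
  preserves arbitrary suprema. This infinite distributive law holds in every complete Boolean
  algebra, with no appeal to complete distributivity.\<close>

lemma inf_SUP_le:
  fixes a :: "'b::{boolean_algebra,complete_lattice}"
  assumes "\<And>x. x \<in> X \<Longrightarrow> a \<sqinter> f x \<le> t"
  shows "a \<sqinter> (SUP x\<in>X. f x) \<le> t"
proof -
  have "(SUP x\<in>X. f x) \<le> - a \<squnion> t"
    using assms by (intro SUP_least) (simp add: shunt1[symmetric] inf.commute)
  then show ?thesis by (simp add: shunt1[symmetric] inf.commute)
qed

text \<open>Contraposition relative to a condition \<open>e\<close>, for the negation and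
  implication cases of \<open>bool_value_subst\<close>.\<close>

lemma inf_uminus_mono:
  fixes e :: "'b::boolean_algebra"
  assumes "e \<sqinter> y \<le> x"
  shows "e \<sqinter> - x \<le> - y"
  using assms by (metis compl_le_compl_iff inf.commute shunt1 sup.commute double_compl)

text \<open>Zorn's lemma applies to the filters containing \<open>c\<close>, starting from the
  principal one. A maximal such filter decides every \<open>a\<close>, since otherwise
  \<open>a\<close> could be adjoined to it.\<close>

lemma exists_ultrafilter:
  fixes c :: "'b::boolean_algebra"
  assumes "c \<noteq> \<bottom>"
  shows "\<exists>U. ba_ultrafilter U \<and> c \<in> U"
proof -
  let ?S = "{F. ba_filter F \<and> c \<in> F}"
  have "{x. c \<le> x} \<in> ?S"
    using assms by (auto simp: ba_filter_def bot_unique)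
  then have ne: "?S \<noteq> {}" by blast
  have "\<Union>\<C> \<in> ?S" if "\<C> \<noteq> {}" and ch: "subset.chain ?S \<C>" for \<C>
  proof -
    have flt: "ba_filter F" "c \<in> F" if "F \<in> \<C>" for F
      using ch that by (auto simp: subset.chain_def)
    have "x \<sqinter> y \<in> \<Union>\<C>" if "x \<in> F" "F \<in> \<C>" "y \<in> G" "G \<in> \<C>" for x y F G
    proof -
      have "F \<subseteq> G \<or> G \<subseteq> F" using ch that by (auto simp: subset.chain_def)
      then show ?thesis using flt that unfolding ba_filter_def by blast
    qed
    then have meet: "\<forall>x y. x \<in> \<Union>\<C> \<longrightarrow> y \<in> \<Union>\<C> \<longrightarrow> x \<sqinter> y \<in> \<Union>\<C>" by blast
    show ?thesis
      using flt \<open>\<C> \<noteq> {}\<close> meet unfolding ba_filter_def by blast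
  qed
  from subset_Zorn_nonempty[OF ne this]
  obtain U where U: "ba_filter U" "c \<in> U"
    and max: "\<And>F. ba_filter F \<Longrightarrow> c \<in> F \<Longrightarrow> U \<subseteq> F \<Longrightarrow> F = U"
    by auto
  have "a \<in> U \<or> - a \<in> U" for a
  proof (rule ccontr)
    assume no: "\<not> (a \<in> U \<or> - a \<in> U)"
    \<comment> \<open>The filter generated by \<open>U\<close> and \<open>a\<close>; it is proper
      exactly because \<open>- a\<close> is not in \<open>U\<close>.\<close>
    let ?G = "{y. \<exists>f\<in>U. f \<sqinter> a \<le> y}"
    have "\<bottom> \<notin> ?G"
    proof
      assume "\<bottom> \<in> ?G"
      then obtain f where "f \<in> U" "f \<le> - a" by (auto simp: shunt1)
      then show False using no U unfolding ba_filter_def by blast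
    qed
    moreover have "x \<sqinter> y \<in> ?G" if xy: "x \<in> ?G" "y \<in> ?G" for x y
    proof -
      obtain f g where "f \<in> U" "g \<in> U" "f \<sqinter> a \<le> x" "g \<sqinter> a \<le> y" using xy by blast
      then have "(f \<sqinter> a) \<sqinter> (g \<sqinter> a) \<le> x \<sqinter> y" by (blast intro: inf_mono)
      then have "(f \<sqinter> g) \<sqinter> a \<le> x \<sqinter> y" by (simp add: ac_simps)
      moreover have "f \<sqinter> g \<in> U"
        using U \<open>f \<in> U\<close> \<open>g \<in> U\<close> unfolding ba_filter_def by blast
      ultimately show ?thesis by blast
    qed
    moreover have "\<top> \<in> ?G" using U by (auto simp: ba_filter_def)
    ultimately have "ba_filter ?G"
      unfolding ba_filter_def by (blast intro: order_trans)
    moreover have "U \<subseteq> ?G" by (auto intro: inf.coboundedI1)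
    ultimately have "?G = U" using max U by blast
    moreover have "a \<in> ?G" using U by (auto simp: ba_filter_def)
    ultimately show False using no by blast
  qed
  with U show ?thesis unfolding ba_ultrafilter_def by blast
qed

section \<open>Ultrafilters and the Boolean operations\<close>

lemma ba_ultrafilter_uminus:
  assumes "ba_ultrafilter U"
  shows "- a \<in> U \<longleftrightarrow> a \<notin> U"
  using assms unfolding ba_ultrafilter_def ba_filter_def
  by (metis inf_compl_bot)

lemma ba_ultrafilter_inf:
  assumes "ba_ultrafilter U"
  shows "a \<sqinter> c \<in> U \<longleftrightarrow> a \<in> U \<and> c \<in> U"
  using assms unfolding ba_ultrafilter_def ba_filter_def
  by (metis inf_le1 inf_le2)

lemma ba_ultrafilter_sup:
  assumes "ba_ultrafilter U"
  shows "a \<squnion> c \<in> U \<longleftrightarrow> a \<in> U \<or> c \<in> U"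
proof -
  have "a \<squnion> c \<in> U \<longleftrightarrow> - a \<sqinter> - c \<notin> U"
    using ba_ultrafilter_uminus[OF assms, of "a \<squnion> c"] by simp
  then show ?thesis
    by (simp add: ba_ultrafilter_inf[OF assms] ba_ultrafilter_uminus[OF assms])
qed

lemma ba_ultrafilter_upward:
  assumes "ba_ultrafilter U" "a \<in> U" "a \<le> c"
  shows "c \<in> U"
  using assms unfolding ba_ultrafilter_def ba_filter_def by blast

section \<open>Equality and membership of names\<close>

lemma eq_value_sym: "eq_value \<iota> u v = eq_value \<iota> v u"
  by (subst (1 2) eq_value.simps) (simp add: inf.commute)

text \<open>Reflexivity at \<open>x\<close> is a hypothesis so that the bound is available inside
  the induction proving \<open>eq_value_refl\<close>.\<close>

lemma name_val_le_mem_value: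
  assumes "x \<in> vdom v" "eq_value \<iota> x x = \<top>"
  shows "name_val \<iota> v x \<le> mem_value \<iota> x v"
  unfolding mem_value.simps[of \<iota> x v]
  by (rule order_trans[OF _ SUP_upper[OF assms(1)]]) (simp add: assms(2))

lemma eq_value_refl: "eq_value \<iota> u u = \<top>"
proof (induction u rule: wf_induct_rule[OF wf_vmem_tc])
  case (1 u)
  have "- name_val \<iota> u x \<squnion> mem_value \<iota> x u = \<top>" if "x \<in> vdom u" for x
  proof -
    have "name_val \<iota> u x \<le> mem_value \<iota> x u"
      using that 1 vdom_vmem_tc by (intro name_val_le_mem_value) auto
    then show ?thesis
      by (metis shunt1 inf_top_left top_unique)
  qed
  then show ?case by (subst eq_value.simps) simp
qed

lemma le_eq_valueI:
  assumes "\<And>x. x \<in> vdom u \<Longrightarrow> a \<sqinter> name_val \<iota> u x \<le> mem_value \<iota> x v"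
    and "\<And>y. y \<in> vdom v \<Longrightarrow> a \<sqinter> name_val \<iota> v y \<le> mem_value \<iota> y u"
  shows "a \<le> eq_value \<iota> u v"
  unfolding eq_value.simps[of \<iota> u v]
  by (intro le_infI INF_greatest) (simp_all add: shunt1[symmetric] assms)

lemma eq_value_name_val_le:
  assumes "x \<in> vdom u"
  shows "eq_value \<iota> u v \<sqinter> name_val \<iota> u x \<le> mem_value \<iota> x v"
proof -
  have "eq_value \<iota> u v \<le> - name_val \<iota> u x \<squnion> mem_value \<iota> x v"
    unfolding eq_value.simps[of \<iota> u v] by (intro le_infI1 INF_lower assms)
  then show ?thesis by (simp add: shunt1[symmetric])
qed

lemma inf_mem_value_leI:
  assumes "\<And>y. y \<in> vdom v \<Longrightarrow> a \<sqinter> (name_val \<iota> v y \<sqinter> eq_value \<iota> y u) \<le> t"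
  shows "a \<sqinter> mem_value \<iota> u v \<le> t"
  unfolding mem_value.simps[of \<iota> u v] by (intro inf_SUP_le assms)

lemma le_mem_value:
  assumes "y \<in> vdom v"
  shows "name_val \<iota> v y \<sqinter> eq_value \<iota> y u \<le> mem_value \<iota> u v"
  unfolding mem_value.simps[of \<iota> u v] by (rule SUP_upper[OF assms])

text \<open>
  Substitutivity in the left argument of \<open>\<in>\<close> is transitivity of \<open>=\<close> one level
  below; it is stated relative to that transitivity so that it can serve inside the induction.
\<close>

lemma mem_value_subst_left_if:
  assumes "\<And>z. z \<in> vdom w \<Longrightarrow> eq_value \<iota> x y \<sqinter> eq_value \<iota> y z \<le> eq_value \<iota> x z"
  shows "eq_value \<iota> x y \<sqinter> mem_value \<iota> y w \<le> mem_value \<iota> x w"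
proof (rule inf_mem_value_leI)
  fix z assume z: "z \<in> vdom w"
  have "eq_value \<iota> x y \<sqinter> (name_val \<iota> w z \<sqinter> eq_value \<iota> z y)
      \<le> name_val \<iota> w z \<sqinter> eq_value \<iota> z x"
    using inf_mono[OF order_refl assms[OF z], of "name_val \<iota> w z"]
    by (simp add: eq_value_sym[of \<iota> z] inf.left_commute)
  also have "\<dots> \<le> mem_value \<iota> x w" using z by (rule le_mem_value)
  finally show "eq_value \<iota> x y \<sqinter> (name_val \<iota> w z \<sqinter> eq_value \<iota> z y) \<le> mem_value \<iota> x w" .
qed

text \<open>A witness \<open>y\<close> for membership in \<open>v\<close> belongs to
  \<open>w\<close> to the extent that \<open>v\<close> equals \<open>w\<close>, and \<open>x\<close>
  can then replace \<open>y\<close>. Transitivity is assumed only for chains starting at the fixed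
  \<open>x\<close>, which is what the induction in \<open>eq_value_trans\<close> supplies.\<close>

lemma mem_value_subst_right_if:
  assumes "\<And>y z. eq_value \<iota> x y \<sqinter> eq_value \<iota> y z \<le> eq_value \<iota> x z"
  shows "eq_value \<iota> v w \<sqinter> mem_value \<iota> x v \<le> mem_value \<iota> x w"
proof (rule inf_mem_value_leI)
  fix y assume y: "y \<in> vdom v"
  have "eq_value \<iota> v w \<sqinter> (name_val \<iota> v y \<sqinter> eq_value \<iota> y x)
      = eq_value \<iota> x y \<sqinter> (eq_value \<iota> v w \<sqinter> name_val \<iota> v y)"
    by (simp add: eq_value_sym[of \<iota> y x] ac_simps)
  also have "\<dots> \<le> eq_value \<iota> x y \<sqinter> mem_value \<iota> y w"
    using eq_value_name_val_le[OF y] by (rule inf_mono[OF order_refl])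
  also have "\<dots> \<le> mem_value \<iota> x w"
    by (rule mem_value_subst_left_if) (rule assms)
  finally show "eq_value \<iota> v w \<sqinter> (name_val \<iota> v y \<sqinter> eq_value \<iota> y x) \<le> mem_value \<iota> x w" .
qed

lemma eq_value_trans: "eq_value \<iota> u v \<sqinter> eq_value \<iota> v w \<le> eq_value \<iota> u w"
proof (induction u arbitrary: v w rule: wf_induct_rule[OF wf_vmem_tc])
  case (1 u)
  have IH: "eq_value \<iota> x y \<sqinter> eq_value \<iota> y z \<le> eq_value \<iota> x z" if "x \<in> vdom u" for x y z
    using 1 vdom_vmem_tc that by blast
  show ?case
  proof (rule le_eq_valueI)
    fix x assume x: "x \<in> vdom u"
    have "eq_value \<iota> u v \<sqinter> eq_value \<iota> v w \<sqinter> name_val \<iota> u x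
        = eq_value \<iota> v w \<sqinter> (eq_value \<iota> u v \<sqinter> name_val \<iota> u x)"
      by (simp add: ac_simps)
    also have "\<dots> \<le> eq_value \<iota> v w \<sqinter> mem_value \<iota> x v"
      using eq_value_name_val_le[OF x] by (rule inf_mono[OF order_refl])
    also have "\<dots> \<le> mem_value \<iota> x w"
      using IH[OF x] by (rule mem_value_subst_right_if)
    finally show "eq_value \<iota> u v \<sqinter> eq_value \<iota> v w \<sqinter> name_val \<iota> u x \<le> mem_value \<iota> x w" .
  next
    fix z assume z: "z \<in> vdom w"
    have "eq_value \<iota> u v \<sqinter> eq_value \<iota> v w \<sqinter> name_val \<iota> w z
        = eq_value \<iota> v u \<sqinter> (eq_value \<iota> w v \<sqinter> name_val \<iota> w z)"
      by (simp add: eq_value_sym[of \<iota> u v] eq_value_sym[of \<iota> v w] ac_simps)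
    also have "\<dots> \<le> eq_value \<iota> v u \<sqinter> mem_value \<iota> z v"
      using eq_value_name_val_le[OF z] by (rule inf_mono[OF order_refl])
    also have "\<dots> \<le> mem_value \<iota> z u"
    proof (rule inf_mem_value_leI)
      fix y assume y: "y \<in> vdom v"
      have "eq_value \<iota> v u \<sqinter> (name_val \<iota> v y \<sqinter> eq_value \<iota> y z)
          = eq_value \<iota> z y \<sqinter> (eq_value \<iota> v u \<sqinter> name_val \<iota> v y)"
        by (simp add: eq_value_sym[of \<iota> y z] ac_simps)
      also have "\<dots> \<le> eq_value \<iota> z y \<sqinter> mem_value \<iota> y u"
        using eq_value_name_val_le[OF y] by (rule inf_mono[OF order_refl])
      also have "\<dots> \<le> mem_value \<iota> z u"
      proof (rule mem_value_subst_left_if)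
        \<comment> \<open>The induction hypothesis covers chains that start in
          \<open>vdom u\<close>. The chain from \<open>z\<close> through \<open>y\<close> to
          \<open>x\<close> ends there, so it is reversed by symmetry.\<close>
        fix x assume "x \<in> vdom u"
        then show "eq_value \<iota> z y \<sqinter> eq_value \<iota> y x \<le> eq_value \<iota> z x"
          using IH[of x y z]
          by (simp add: eq_value_sym[of \<iota> z] eq_value_sym[of \<iota> y x] inf.commute)
      qed
      finally show "eq_value \<iota> v u \<sqinter> (name_val \<iota> v y \<sqinter> eq_value \<iota> y z) \<le> mem_value \<iota> z u" .
    qed
    finally show "eq_value \<iota> u v \<sqinter> eq_value \<iota> v w \<sqinter> name_val \<iota> w z \<le> mem_value \<iota> z u" .
  qed
qed

section \<open>Substitution of equals in formulas\<close>

lemma mem_value_subst_left: "eq_value \<iota> x y \<sqinter> mem_value \<iota> x w \<le> mem_value \<iota> y w"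
  using mem_value_subst_left_if[OF eq_value_trans] eq_value_sym by metis

lemma mem_value_subst_right: "eq_value \<iota> v w \<sqinter> mem_value \<iota> x v \<le> mem_value \<iota> x w"
  by (rule mem_value_subst_right_if) (rule eq_value_trans)

lemma mem_value_subst:
  assumes "e \<le> eq_value \<iota> u u'" "e \<le> eq_value \<iota> v v'"
  shows "e \<sqinter> mem_value \<iota> u v \<le> mem_value \<iota> u' v'"
proof -
  have "e \<sqinter> mem_value \<iota> u v \<le> eq_value \<iota> v v' \<sqinter> (eq_value \<iota> u u' \<sqinter> mem_value \<iota> u v)"
    using assms by (auto intro: inf.coboundedI1)
  also have "\<dots> \<le> eq_value \<iota> v v' \<sqinter> mem_value \<iota> u' v"
    using mem_value_subst_left by (rule inf_mono[OF order_refl])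
  also have "\<dots> \<le> mem_value \<iota> u' v'" by (rule mem_value_subst_right)
  finally show ?thesis .
qed

lemma eq_value_subst:
  assumes "e \<le> eq_value \<iota> u u'" "e \<le> eq_value \<iota> v v'"
  shows "e \<sqinter> eq_value \<iota> u v \<le> eq_value \<iota> u' v'"
proof -
  have "e \<sqinter> eq_value \<iota> u v \<le> eq_value \<iota> u' u \<sqinter> (eq_value \<iota> u v \<sqinter> eq_value \<iota> v v')"
    using assms by (auto intro: inf.coboundedI1 simp: eq_value_sym[of \<iota> u' u])
  also have "\<dots> \<le> eq_value \<iota> u' u \<sqinter> eq_value \<iota> u v'"
    using eq_value_trans by (rule inf_mono[OF order_refl])
  also have "\<dots> \<le> eq_value \<iota> u' v'" by (rule eq_value_trans)
  finally show ?thesis .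
qed

text \<open>One element \<open>e\<close> bounds all parameter equalities, so it survives the
  quantifiers: the same name is pushed onto both lists, where equality has value \<top>. Negation
  and implication exchange the roles of \<open>us\<close> and \<open>vs\<close>, which symmetry of
  equality permits.\<close>

lemma bool_value_subst:
  assumes "free_below (length us) \<phi>" "length vs = length us"
    and "\<And>i. i < length us \<Longrightarrow> e \<le> eq_value \<iota> (us ! i) (vs ! i)"
  shows "e \<sqinter> bool_value \<iota> us \<phi> \<le> bool_value \<iota> vs \<phi>"
  using assms
proof (induction \<phi> arbitrary: us vs)
  case (Member i j)
  then show ?case by (simp add: mem_value_subst)
next
  case (Equal i j)
  then show ?case by (simp add: eq_value_subst)
next
  case (Neg \<phi>)
  have "e \<sqinter> bool_value \<iota> vs \<phi> \<le> bool_value \<iota> us \<phi>"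
    using Neg.prems by (intro Neg.IH) (auto simp: eq_value_sym[of \<iota> "vs ! _"])
  then show ?case by (simp add: inf_uminus_mono)
next
  case (Conj \<phi> \<psi>)
  have "e \<sqinter> bool_value \<iota> us \<phi> \<le> bool_value \<iota> vs \<phi>" "e \<sqinter> bool_value \<iota> us \<psi> \<le> bool_value \<iota> vs \<psi>"
    using Conj.prems by (auto intro!: Conj.IH)
  then have "(e \<sqinter> bool_value \<iota> us \<phi>) \<sqinter> (e \<sqinter> bool_value \<iota> us \<psi>)
      \<le> bool_value \<iota> vs \<phi> \<sqinter> bool_value \<iota> vs \<psi>"
    by (rule inf_mono)
  then show ?case by (simp add: ac_simps)
next
  case (Disj \<phi> \<psi>)
  have "e \<sqinter> bool_value \<iota> us \<phi> \<le> bool_value \<iota> vs \<phi>" "e \<sqinter> bool_value \<iota> us \<psi> \<le> bool_value \<iota> vs \<psi>"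
    using Disj.prems by (auto intro!: Disj.IH)
  then show ?case by (simp add: inf_sup_distrib1 le_supI1 le_supI2)
next
  case (Impl \<phi> \<psi>)
  have "e \<sqinter> bool_value \<iota> vs \<phi> \<le> bool_value \<iota> us \<phi>"
    using Impl.prems by (intro Impl.IH) (auto simp: eq_value_sym[of \<iota> "vs ! _"])
  then have "e \<sqinter> - bool_value \<iota> us \<phi> \<le> - bool_value \<iota> vs \<phi>" by (rule inf_uminus_mono)
  moreover have "e \<sqinter> bool_value \<iota> us \<psi> \<le> bool_value \<iota> vs \<psi>"
    using Impl.prems by (auto intro!: Impl.IH)
  ultimately show ?case by (simp add: inf_sup_distrib1 le_supI1 le_supI2)
next
  case (Forall \<phi>)
  have step: "e \<sqinter> bool_value \<iota> (u # us) \<phi> \<le> bool_value \<iota> (u # vs) \<phi>" for u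
    using Forall.prems by (intro Forall.IH) (auto simp: nth_Cons eq_value_refl split: nat.split)
  have "e \<sqinter> (INF u\<in>names \<iota>. bool_value \<iota> (u # us) \<phi>) \<le> bool_value \<iota> (u # vs) \<phi>"
    if "u \<in> names \<iota>" for u
    using inf_mono[OF order_refl INF_lower[OF that]] step by (rule order_trans)
  then show ?case by (auto intro: INF_greatest)
next
  case (Exists \<phi>)
  have step: "e \<sqinter> bool_value \<iota> (u # us) \<phi> \<le> bool_value \<iota> (u # vs) \<phi>" for u
    using Exists.prems by (intro Exists.IH) (auto simp: nth_Cons eq_value_refl split: nat.split)
  have "e \<sqinter> bool_value \<iota> (u # us) \<phi> \<le> (SUP u\<in>names \<iota>. bool_value \<iota> (u # vs) \<phi>)"
    if "u \<in> names \<iota>" for u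
    using step SUP_upper[OF that] by (rule order_trans)
  then show ?case by (auto intro: inf_SUP_le)
qed

section \<open>Sets of the universe\<close>

text \<open>These are the classes on which \<open>vset\<close> is meaningful: sets, as opposed to
  proper classes.\<close>

definition small :: "'v::zfc_universe set \<Rightarrow> bool" where
  "small X \<longleftrightarrow> (\<exists>z. elts z = X)"

lemma elts_vset_small: "small X \<Longrightarrow> elts (vset X) = X"
  unfolding small_def using elts_vset by blast

lemma small_elts [simp]: "small (elts x)"
  unfolding small_def by blast

lemma small_subset:
  assumes "small X" "Y \<subseteq> X"
  shows "small Y"
proof -
  obtain x where "elts x = X" using assms(1) unfolding small_def by blast
  then have "{y \<in> elts x. y \<in> Y} = Y" using assms(2) by blast
  then show ?thesis using separation[of x "\<lambda>y. y \<in> Y"] unfolding small_def by simp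
qed

lemma small_image:
  fixes f :: "'v::zfc_universe \<Rightarrow> 'v"
  assumes "small X"
  shows "small (f ` X)"
proof -
  obtain x where "elts x = X" using assms unfolding small_def by blast
  then show ?thesis using replacement[of f x] unfolding small_def by simp
qed

text \<open>Replacement first collects the codes \<open>vset (f x)\<close> into one set, to which
  the union axiom applies.\<close>

lemma small_UN:
  fixes f :: "'v::zfc_universe \<Rightarrow> 'v set"
  assumes "small X" "\<And>x. x \<in> X \<Longrightarrow> small (f x)"
  shows "small (\<Union>x\<in>X. f x)"
proof -
  obtain z where z: "elts z = (\<lambda>x. vset (f x)) ` X"
    using small_image[OF assms(1), of "\<lambda>x. vset (f x)"] unfolding small_def by blast
  have "(\<Union>y\<in>elts z. elts y) = (\<Union>x\<in>X. f x)"
    unfolding z using assms(2) by (simp add: elts_vset_small)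
  then show ?thesis using union[of z] unfolding small_def by simp
qed

lemma small_insert_elts: "small (insert x (elts x))"
proof -
  have "small (\<Union>y\<in>elts (vset {vset {x}, x}). elts y)"
    by (rule small_UN[where f = elts, OF small_elts small_elts])
  then show ?thesis by simp
qed

lemma vpair_inject: "vpair a b = vpair c d \<longleftrightarrow> a = c \<and> b = d"
proof
  assume "vpair a b = vpair c d"
  then have "elts (vpair a b) = elts (vpair c d)" by simp
  then have "{vset {a}, vset {a, b}} = {vset {c}, vset {c, d}}" unfolding elts_vpair .
  \<comment> \<open>Applying \<open>elts\<close> to the members strips the inner codes and leaves
    Kuratowski pairs of HOL sets.\<close>
  then have "elts ` {vset {a}, vset {a, b}} = elts ` {vset {c}, vset {c, d}}" by (rule arg_cong)
  then have "{{a}, {a, b}} = {{c}, {c, d}}" by simp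
  then show "a = c \<and> b = d" by (auto simp: doubleton_eq_iff)
qed simp

text \<open>The domain lies in the image of \<open>elts f\<close> under a choice of first
  components. Elements that are not pairs can only enlarge this image, which is harmless for a
  subset argument.\<close>

lemma small_vdom: "small (vdom f)"
proof (rule small_subset)
  show "small ((\<lambda>z. SOME a. \<exists>b. z = vpair a b) ` elts f)" by (simp add: small_image)
  show "vdom f \<subseteq> (\<lambda>z. SOME a. \<exists>b. z = vpair a b) ` elts f"
  proof
    fix a assume "a \<in> vdom f"
    then obtain b where "vpair a b \<in> elts f" unfolding vdom_def by blast
    moreover have "a = (SOME a'. \<exists>b'. vpair a b = vpair a' b')"
      by (simp add: vpair_inject)
    ultimately show "a \<in> (\<lambda>z. SOME a. \<exists>b. z = vpair a b) ` elts f" by (rule rev_image_eqI)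
  qed
qed

section \<open>Ordinals of the universe\<close>

lemma vordinal_elts: "vordinal \<alpha> \<Longrightarrow> \<xi> \<in> elts \<alpha> \<Longrightarrow> vordinal \<xi>"
  unfolding vordinal_def vtransitive_def by blast

text \<open>Here \<beta> is the supremum of the ordinals in \<open>X\<close> and \<alpha> its
  successor. Both are needed because a name at level \<alpha> must have its domain inside a level
  indexed by an element of \<alpha>.\<close>

lemma exists_vordinal_above:
  assumes "small X" "\<And>x. x \<in> X \<Longrightarrow> vordinal x"
  shows "\<exists>\<alpha>. vordinal \<alpha> \<and> (\<exists>\<beta>\<in>elts \<alpha>. \<forall>x\<in>X. elts x \<subseteq> elts \<beta>)"
proof -
  have "small (\<Union>x\<in>X. elts x)" using assms(1) by (rule small_UN) simp
  then obtain \<beta> where \<beta>: "elts \<beta> = (\<Union>x\<in>X. elts x)" unfolding small_def by blast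
  obtain \<alpha> where \<alpha>: "elts \<alpha> = insert \<beta> (elts \<beta>)"
    using small_insert_elts unfolding small_def by blast
  have "vordinal \<alpha>"
    using assms(2) unfolding vordinal_def vtransitive_def \<alpha> \<beta>
    by (auto simp: \<beta>) blast+
  then show ?thesis using \<alpha> \<beta> by (intro exI[of _ \<alpha>] conjI bexI[of _ \<beta>]) auto
qed

section \<open>The maximum principle\<close>

lemma name_level_mono: "elts \<alpha> \<subseteq> elts \<beta> \<Longrightarrow> name_level \<iota> \<alpha> \<subseteq> name_level \<iota> \<beta>"
  by (subst (1 2) name_level.simps) blast

lemma names_vdom_level:
  assumes "u \<in> names \<iota>"
  shows "\<exists>\<xi>. vordinal \<xi> \<and> vdom u \<subseteq> name_level \<iota> \<xi>"
proof -
  obtain \<alpha> where "vordinal \<alpha>" "u \<in> name_level \<iota> \<alpha>"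
    using assms unfolding names_def by blast
  then show ?thesis using vordinal_elts by (subst (asm) name_level.simps) blast
qed

text \<open>The Boolean values \<open>f\<close> may be prescribed freely: \<open>w\<close> is the
  graph of \<open>f\<close> on the combined domain, a set by replacement. Only its level needs an
  argument.\<close>

lemma exists_name:
  fixes \<iota> :: "'b \<Rightarrow> 'v::zfc_universe" and I :: "'v set"
  assumes "set_presentation \<iota>" "small I" "\<And>i. i \<in> I \<Longrightarrow> u i \<in> names \<iota>"
  shows "\<exists>w\<in>names \<iota>. vdom w = (\<Union>i\<in>I. vdom (u i)) \<and>
    (\<forall>x\<in>vdom w. name_val \<iota> w x = f x)"
proof -
  let ?D = "\<Union>i\<in>I. vdom (u i)"
  have "small ?D" using assms(2) small_vdom by (rule small_UN)
  then obtain w where w: "elts w = (\<lambda>x. vpair x (\<iota> (f x))) ` ?D"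
    using small_image[of ?D "\<lambda>x. vpair x (\<iota> (f x))"] unfolding small_def by blast
  have dom: "vdom w = ?D" unfolding vdom_def[of w] w by (auto simp: vpair_inject)
  have fn: "vfunction w" unfolding vfunction_def w by (auto simp: vpair_inject)
  have ran: "vran w \<subseteq> range \<iota>" unfolding vran_def w by (auto simp: vpair_inject)
  have val: "name_val \<iota> w x = f x" if "x \<in> ?D" for x
  proof -
    have "vpair x b \<in> elts w \<longleftrightarrow> b = \<iota> (f x)" for b
      using that unfolding w by (auto simp: vpair_inject)
    then have "vapp w x = \<iota> (f x)" unfolding vapp_def by simp
    then show ?thesis
      using assms(1) unfolding name_val_def set_presentation_def by simp
  qed
  \<comment> \<open>A level is chosen for each domain; as \<open>I\<close> is small, the chosen
    ordinals have a common bound.\<close>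
  have "\<forall>i\<in>I. \<exists>\<xi>. vordinal \<xi> \<and> vdom (u i) \<subseteq> name_level \<iota> \<xi>"
    using names_vdom_level[OF assms(3)] by blast
  from bchoice[OF this] obtain \<xi>
    where \<xi>: "\<And>i. i \<in> I \<Longrightarrow> vordinal (\<xi> i) \<and> vdom (u i) \<subseteq> name_level \<iota> (\<xi> i)"
    by blast
  obtain \<alpha> \<beta> where \<alpha>: "vordinal \<alpha>" "\<beta> \<in> elts \<alpha>" "\<forall>i\<in>I. elts (\<xi> i) \<subseteq> elts \<beta>"
    using exists_vordinal_above[of "\<xi> ` I"] small_image[OF assms(2)] \<xi> by auto
  have "vdom w \<subseteq> name_level \<iota> \<beta>"
    unfolding dom using \<xi> \<alpha>(3) name_level_mono by blast
  then have "w \<in> name_level \<iota> \<alpha>"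
    using fn ran \<alpha>(2) by (subst name_level.simps) blast
  then have "w \<in> names \<iota>" using \<alpha>(1) unfolding names_def by blast
  then show ?thesis using dom val by auto
qed

text \<open>The conditions in \<open>A\<close> are pairwise disjoint, so below \<open>a\<close> only
  the summand with \<open>c = a\<close> contributes to the values of the mixture, which therefore
  agrees there with \<open>u a\<close>.\<close>

lemma mixing:
  fixes \<iota> :: "'b::{boolean_algebra,complete_lattice} \<Rightarrow> 'v::zfc_universe"
  assumes "set_presentation \<iota>"
    and disj: "\<And>a c. a \<in> A \<Longrightarrow> c \<in> A \<Longrightarrow> a \<noteq> c \<Longrightarrow> a \<sqinter> c = \<bottom>"
    and u: "\<And>a. a \<in> A \<Longrightarrow> u a \<in> names \<iota>"
  shows "\<exists>w\<in>names \<iota>. \<forall>a\<in>A. a \<le> eq_value \<iota> w (u a)"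
proof -
  have inj: "inj \<iota>" and rng: "small (range \<iota>)"
    using assms(1) unfolding set_presentation_def small_def by auto
  \<comment> \<open>The family \<open>A\<close> lives in the algebra, so \<iota> carries it into the
    universe to serve as an index set.\<close>
  have sm: "small (\<iota> ` A)" using rng by (rule small_subset) blast
  \<comment> \<open>The weight of \<open>x\<close> uses \<open>mem_value\<close> rather than
    \<open>name_val\<close>, since \<open>x\<close> may lie outside the domain of
    \<open>u c\<close>, where \<open>name_val\<close> is meaningless.\<close>
  define f where "f x = (SUP c\<in>A. c \<sqinter> mem_value \<iota> x (u c))" for x
  have "\<exists>w\<in>names \<iota>. vdom w = (\<Union>i\<in>\<iota> ` A. vdom (u (inv \<iota> i))) \<and>
      (\<forall>x\<in>vdom w. name_val \<iota> w x = f x)"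
    by (rule exists_name[OF assms(1) sm]) (use u inj in auto)
  moreover have "(\<Union>i\<in>\<iota> ` A. vdom (u (inv \<iota> i))) = (\<Union>a\<in>A. vdom (u a))"
    using inj by simp
  ultimately obtain w where w: "w \<in> names \<iota>" "vdom w = (\<Union>a\<in>A. vdom (u a))"
    and val: "\<And>x. x \<in> vdom w \<Longrightarrow> name_val \<iota> w x = f x"
    by metis
  have "a \<le> eq_value \<iota> w (u a)" if a: "a \<in> A" for a
  proof (rule le_eq_valueI)
    fix x assume x: "x \<in> vdom w"
    have "a \<sqinter> (c \<sqinter> mem_value \<iota> x (u c)) \<le> mem_value \<iota> x (u a)" if "c \<in> A" for c
    proof (cases "c = a")
      case False
      then have "a \<sqinter> c = \<bottom>" using disj a that by blast
      then show ?thesis by (simp add: inf.assoc[symmetric])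
    qed (simp add: inf.coboundedI2)
    then show "a \<sqinter> name_val \<iota> w x \<le> mem_value \<iota> x (u a)"
      unfolding val[OF x] f_def by (rule inf_SUP_le)
  next
    fix y assume y: "y \<in> vdom (u a)"
    then have yw: "y \<in> vdom w" using w a by blast
    have "a \<sqinter> name_val \<iota> (u a) y \<le> a \<sqinter> mem_value \<iota> y (u a)"
      using name_val_le_mem_value[OF y eq_value_refl] by (rule inf_mono[OF order_refl])
    also have "\<dots> \<le> name_val \<iota> w y"
      unfolding val[OF yw] f_def using a by (rule SUP_upper)
    also have "\<dots> \<le> mem_value \<iota> y w" by (rule name_val_le_mem_value[OF yw eq_value_refl])
    finally show "a \<sqinter> name_val \<iota> (u a) y \<le> mem_value \<iota> y w" .
  qed
  then show ?thesis using w(1) by blast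
qed

text \<open>Zorn's lemma gives a maximal pairwise disjoint subset of \<open>S\<close>. An element of
  \<open>S\<close> disjoint from all of \<open>A\<close> could be added, so it is already in
  \<open>A\<close>, hence disjoint from itself and equal to \<bottom>. The element \<bottom> is not
  excluded from \<open>A\<close>.\<close>

lemma maximal_antichain:
  fixes S :: "'b::boolean_algebra set"
  assumes "\<And>a c. a \<in> S \<Longrightarrow> c \<le> a \<Longrightarrow> c \<in> S"
  obtains A where "A \<subseteq> S" "\<forall>a\<in>A. \<forall>c\<in>A. a \<noteq> c \<longrightarrow> a \<sqinter> c = \<bottom>"
    "\<forall>s\<in>S. (\<forall>a\<in>A. a \<sqinter> s = \<bottom>) \<longrightarrow> s = \<bottom>"
proof -
  let ?P = "{A. A \<subseteq> S \<and> (\<forall>a\<in>A. \<forall>c\<in>A. a \<noteq> c \<longrightarrow> a \<sqinter> c = \<bottom>)}"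
  have "\<exists>M\<in>?P. \<forall>X\<in>?P. M \<subseteq> X \<longrightarrow> X = M"
  proof (rule subset_Zorn_nonempty)
    fix \<C> assume "\<C> \<noteq> {}" and ch: "subset.chain ?P \<C>"
    have "a \<sqinter> c = \<bottom>" if "a \<in> X" "X \<in> \<C>" "c \<in> Y" "Y \<in> \<C>" "a \<noteq> c" for a c X Y
    proof -
      have "X \<subseteq> Y \<or> Y \<subseteq> X" "X \<in> ?P" "Y \<in> ?P"
        using ch that unfolding subset_chain_def by blast+
      then show ?thesis using that by blast
    qed
    moreover have "\<Union>\<C> \<subseteq> S" using ch by (auto simp: subset.chain_def)
    ultimately show "\<Union>\<C> \<in> ?P" by blast
  qed blast
  then obtain A where A: "A \<in> ?P" and max: "\<forall>X\<in>?P. A \<subseteq> X \<longrightarrow> X = A" by (rule bexE)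
  have "s = \<bottom>" if "s \<in> S" "\<And>a. a \<in> A \<Longrightarrow> a \<sqinter> s = \<bottom>" for s
  proof -
    have "insert s A \<in> ?P" using A that by (auto simp: inf.commute)
    from bspec[OF max this] have "s \<in> A" by blast
    then show ?thesis using that(2)[of s] by simp
  qed
  then show thesis using A by (intro that[of A]) simp_all
qed

text \<open>The function \<open>f\<close> stands for the value of a formula at a varying name, and
  \<open>ext\<close> is its substitutivity. Keeping \<open>f\<close> abstract lets the principle
  serve a formula and its negation alike.\<close>

lemma maximum_principle:
  fixes \<iota> :: "'b::{boolean_algebra,complete_lattice} \<Rightarrow> 'v::zfc_universe"
  assumes "set_presentation \<iota>"
    and ext: "\<And>u v. u \<in> names \<iota> \<Longrightarrow> v \<in> names \<iota> \<Longrightarrow> eq_value \<iota> u v \<sqinter> f u \<le> f v"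
  shows "\<exists>w\<in>names \<iota>. \<forall>u\<in>names \<iota>. f u \<le> f w"
proof -
  define S where "S = {a. \<exists>u\<in>names \<iota>. a \<le> f u}"
  have "c \<in> S" if "a \<in> S" "c \<le> a" for a c
    using that order_trans[OF that(2)] by (auto simp: S_def)
  then obtain A
    where A: "A \<subseteq> S" "\<forall>a\<in>A. \<forall>c\<in>A. a \<noteq> c \<longrightarrow> a \<sqinter> c = \<bottom>"
      and max: "\<forall>s\<in>S. (\<forall>a\<in>A. a \<sqinter> s = \<bottom>) \<longrightarrow> s = \<bottom>"
    by (rule maximal_antichain)
  have "\<forall>a\<in>A. \<exists>u. u \<in> names \<iota> \<and> a \<le> f u" using A(1) by (auto simp: S_def)
  from bchoice[OF this] obtain u where u: "\<And>a. a \<in> A \<Longrightarrow> u a \<in> names \<iota> \<and> a \<le> f (u a)"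
    by blast
  obtain w where w: "w \<in> names \<iota>" "\<And>a. a \<in> A \<Longrightarrow> a \<le> eq_value \<iota> w (u a)"
    using mixing[OF assms(1), of A u] A(2) u by blast
  have le: "a \<le> f w" if "a \<in> A" for a
  proof -
    have "a \<le> eq_value \<iota> (u a) w \<sqinter> f (u a)"
      using u w that by (simp add: eq_value_sym[of \<iota> "u a"])
    also have "\<dots> \<le> f w" using ext u w that by blast
    finally show ?thesis .
  qed
  have "f v \<le> f w" if "v \<in> names \<iota>" for v
  proof -
    \<comment> \<open>The part of \<open>f v\<close> outside \<open>f w\<close> still lies in
      \<open>S\<close>, yet it misses every condition of the antichain, as these all lie below
      \<open>f w\<close>. Maximality leaves only \<bottom>.\<close>
    have "f v \<sqinter> - f w = \<bottom>"
    proof (rule max[rule_format])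
      show "f v \<sqinter> - f w \<in> S" using that by (auto simp: S_def intro: inf.coboundedI1)
      fix a assume "a \<in> A"
      then have "a \<sqinter> - f w = \<bottom>" using le by (simp add: shunt1 flip: bot_unique)
      then show "a \<sqinter> (f v \<sqinter> - f w) = \<bottom>" by (simp only: inf.left_commute[of a] inf_bot_right)
    qed
    then show ?thesis by (simp add: shunt1 flip: bot_unique)
  qed
  then show ?thesis using w(1) by blast
qed

section \<open>The quotient by an ultrafilter\<close>

lemma equiv_name_equiv:
  assumes "ba_ultrafilter U"
  shows "equiv (names \<iota>) (name_equiv \<iota> U)"
proof (rule equivI)
  show "name_equiv \<iota> U \<subseteq> names \<iota> \<times> names \<iota>" by (auto simp: name_equiv_def)
  show "refl_on (names \<iota>) (name_equiv \<iota> U)"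
    using assms by (auto simp: refl_on_def name_equiv_def eq_value_refl ba_ultrafilter_def ba_filter_def)
  show "sym (name_equiv \<iota> U)"
    by (auto simp: sym_def name_equiv_def eq_value_sym)
  show "trans (name_equiv \<iota> U)"
    using assms eq_value_trans ba_ultrafilter_inf ba_ultrafilter_upward
    unfolding trans_def name_equiv_def by blast
qed

lemma name_class_eq_iff:
  assumes "ba_ultrafilter U" "u \<in> names \<iota>" "v \<in> names \<iota>"
  shows "name_equiv \<iota> U `` {u} = name_equiv \<iota> U `` {v} \<longleftrightarrow> eq_value \<iota> u v \<in> U"
  using eq_equiv_class_iff[OF equiv_name_equiv[OF assms(1)] assms(2,3)] assms(2,3)
  by (simp add: name_equiv_def)

text \<open>\<open>quotient_mem\<close> asks for some representatives; substitutivity of membership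
  makes their choice irrelevant.\<close>

lemma quotient_mem_iff:
  assumes "ba_ultrafilter U" "u \<in> names \<iota>" "v \<in> names \<iota>"
  shows "quotient_mem \<iota> U (name_equiv \<iota> U `` {u}) (name_equiv \<iota> U `` {v}) \<longleftrightarrow> mem_value \<iota> u v \<in> U"
proof
  assume "quotient_mem \<iota> U (name_equiv \<iota> U `` {u}) (name_equiv \<iota> U `` {v})"
  then obtain u' v' where n: "u' \<in> names \<iota>" "v' \<in> names \<iota>"
    and c: "name_equiv \<iota> U `` {u} = name_equiv \<iota> U `` {u'}"
      "name_equiv \<iota> U `` {v} = name_equiv \<iota> U `` {v'}"
    and m: "mem_value \<iota> u' v' \<in> U"
    unfolding quotient_mem_def by blast
  have "eq_value \<iota> u' u \<in> U" "eq_value \<iota> v' v \<in> U"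
    using c n assms by (simp_all add: name_class_eq_iff eq_value_sym)
  then have "eq_value \<iota> u' u \<sqinter> eq_value \<iota> v' v \<sqinter> mem_value \<iota> u' v' \<in> U"
    using m assms(1) by (simp add: ba_ultrafilter_inf)
  moreover have "eq_value \<iota> u' u \<sqinter> eq_value \<iota> v' v \<sqinter> mem_value \<iota> u' v' \<le> mem_value \<iota> u v"
    by (rule mem_value_subst) simp_all
  ultimately show "mem_value \<iota> u v \<in> U" using ba_ultrafilter_upward assms(1) by blast
qed (use assms in \<open>auto simp: quotient_mem_def\<close>)

text \<open>Provides the hypothesis \<open>ext\<close> of \<open>maximum_principle\<close> for the
  variable bound by a quantifier.\<close>

lemma bool_value_subst_head:
  assumes "free_below (Suc (length us)) \<phi>"
  shows "eq_value \<iota> u v \<sqinter> bool_value \<iota> (u # us) \<phi> \<le> bool_value \<iota> (v # us) \<phi>"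
  using assms by (intro bool_value_subst) (auto simp: nth_Cons eq_value_refl split: nat.split)

section \<open>Attained quantifier values and Los's theorem\<close>

lemma bool_value_Exists_attained:
  assumes "set_presentation \<iota>" "free_below (Suc (length us)) \<phi>"
  shows "\<exists>w\<in>names \<iota>. bool_value \<iota> us (Exists \<phi>) = bool_value \<iota> (w # us) \<phi>"
proof -
  have "\<exists>w\<in>names \<iota>. \<forall>u\<in>names \<iota>. bool_value \<iota> (u # us) \<phi> \<le> bool_value \<iota> (w # us) \<phi>"
    using assms by (intro maximum_principle bool_value_subst_head)
  then obtain w where "w \<in> names \<iota>"
    "\<And>u. u \<in> names \<iota> \<Longrightarrow> bool_value \<iota> (u # us) \<phi> \<le> bool_value \<iota> (w # us) \<phi>"
    by auto
  then show ?thesis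
    by (auto intro!: bexI[of _ w] antisym SUP_least SUP_upper)
qed

text \<open>Dual to the existential case: a name maximising the value of the negation minimises that
  of the formula.\<close>

lemma bool_value_Forall_attained:
  assumes "set_presentation \<iota>" "free_below (Suc (length us)) \<phi>"
  shows "\<exists>w\<in>names \<iota>. bool_value \<iota> us (Forall \<phi>) = bool_value \<iota> (w # us) \<phi>"
proof -
  have "\<exists>w\<in>names \<iota>. \<forall>u\<in>names \<iota>. bool_value \<iota> (u # us) (Neg \<phi>) \<le> bool_value \<iota> (w # us) (Neg \<phi>)"
    using assms by (intro maximum_principle bool_value_subst_head) simp_all
  then obtain w where "w \<in> names \<iota>"
    "\<And>u. u \<in> names \<iota> \<Longrightarrow> bool_value \<iota> (w # us) \<phi> \<le> bool_value \<iota> (u # us) \<phi>"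
    by auto
  then show ?thesis
    by (auto intro!: bexI[of _ w] antisym INF_greatest INF_lower)
qed

theorem sat_quotient_iff:
  fixes \<iota> :: "'b::{boolean_algebra,complete_lattice} \<Rightarrow> 'v::zfc_universe"
  assumes \<iota>: "set_presentation \<iota>" and U: "ba_ultrafilter U"
    and "set us \<subseteq> names \<iota>" "free_below (length us) \<phi>"
  shows "sat (quotient_domain \<iota> U) (quotient_mem \<iota> U) (map (\<lambda>u. name_equiv \<iota> U `` {u}) us) \<phi>
    \<longleftrightarrow> bool_value \<iota> us \<phi> \<in> U"
  using assms(3,4)
proof (induction \<phi> arbitrary: us)
  case (Member i j)
  then have "us ! i \<in> names \<iota>" "us ! j \<in> names \<iota>" by auto
  then show ?case using Member.prems by (simp add: quotient_mem_iff[OF U])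
next
  case (Equal i j)
  then have "us ! i \<in> names \<iota>" "us ! j \<in> names \<iota>" by auto
  then show ?case using Equal.prems by (simp add: name_class_eq_iff[OF U])
next
  case (Forall \<phi>)
  let ?val = "\<lambda>u. bool_value \<iota> (u # us) \<phi>"
  have "sat (quotient_domain \<iota> U) (quotient_mem \<iota> U) (map (\<lambda>u. name_equiv \<iota> U `` {u}) us) (Forall \<phi>)
      \<longleftrightarrow> (\<forall>u\<in>names \<iota>. ?val u \<in> U)"
    using Forall.prems Forall.IH[of "_ # us"] by (auto simp: quotient_domain_def quotient_def)
  \<comment> \<open>An ultrafilter need not be closed under infinite meets. The name
    \<open>w\<close> attains the infimum, so membership of that single value in \<open>U\<close>
    decides the quantifier.\<close>
  moreover obtain w where "w \<in> names \<iota>" "bool_value \<iota> us (Forall \<phi>) = ?val w"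
    using bool_value_Forall_attained[OF \<iota>, of us \<phi>] Forall.prems(2) unfolding free_below.simps by blast
  moreover have "bool_value \<iota> us (Forall \<phi>) \<le> ?val u" if "u \<in> names \<iota>" for u
    using that by (auto intro: INF_lower)
  ultimately show ?case using ba_ultrafilter_upward[OF U] by metis
next
  case (Exists \<phi>)
  let ?val = "\<lambda>u. bool_value \<iota> (u # us) \<phi>"
  have "sat (quotient_domain \<iota> U) (quotient_mem \<iota> U) (map (\<lambda>u. name_equiv \<iota> U `` {u}) us) (Exists \<phi>)
      \<longleftrightarrow> (\<exists>u\<in>names \<iota>. ?val u \<in> U)"
    using Exists.prems Exists.IH[of "_ # us"] by (auto simp: quotient_domain_def quotient_def)
  moreover obtain w where "w \<in> names \<iota>" "bool_value \<iota> us (Exists \<phi>) = ?val w"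
    using bool_value_Exists_attained[OF \<iota>, of us \<phi>] Exists.prems(2) unfolding free_below.simps by blast
  moreover have "?val u \<le> bool_value \<iota> us (Exists \<phi>)" if "u \<in> names \<iota>" for u
    using that by (auto intro: SUP_upper)
  ultimately show ?case using ba_ultrafilter_upward[OF U] by metis
qed (auto simp: ba_ultrafilter_uminus[OF U] ba_ultrafilter_inf[OF U] ba_ultrafilter_sup[OF U])

theorem proposition3p12:
  fixes \<iota> :: "'b::{boolean_algebra,complete_lattice} \<Rightarrow> 'v::zfc_universe"
    and p :: fm and b :: 'b
  assumes "set_presentation \<iota>"
    and "p \<in> sentences"
  shows "internal_sat \<iota> b (Diamond (Atom p)) \<longleftrightarrow>
         (\<exists>U. ba_ultrafilter U \<and> b \<in> U \<and> quotient_models \<iota> U p)"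
proof -
  let ?p = "bool_value \<iota> [] p"
  have los: "quotient_models \<iota> U p \<longleftrightarrow> ?p \<in> U" if "ba_ultrafilter U" for U
    using sat_quotient_iff[OF assms(1) that, of "[]" p] assms(2)
    by (simp add: quotient_models_def sentences_def)
  \<comment> \<open>The states satisfying the atom are those below \<open>?p\<close>. If one of them
    is compatible with \<open>b\<close>, then so is \<open>?p\<close> itself, which is the witness
    for the converse. For \<open>b = \<bottom>\<close> both sides fail.\<close>
  have "internal_sat \<iota> b (Diamond (Atom p)) \<longleftrightarrow> b \<sqinter> ?p \<noteq> \<bottom>"
    unfolding internal_sat_def compat_def modal_sat.simps
    by (metis bot_unique inf_mono order_refl)
  \<comment> \<open>A nonzero element extends to an ultrafilter, and no filter contains
    \<bottom>.\<close>
  also have "\<dots> \<longleftrightarrow> (\<exists>U. ba_ultrafilter U \<and> b \<sqinter> ?p \<in> U)"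
    using exists_ultrafilter by (auto simp: ba_ultrafilter_def ba_filter_def)
  also have "\<dots> \<longleftrightarrow> (\<exists>U. ba_ultrafilter U \<and> b \<in> U \<and> quotient_models \<iota> U p)"
    using los ba_ultrafilter_inf by blast
  finally show ?thesis .
qed

end
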